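(* Let $\lambda>0$, let $d\eta_\lambda=|x|^\lambda\,dx$ on $\mathbb{R}$, and let $p\ge 2(\lambda+1)$. There exist a constant $C(p,\lambda)>0$ depending only on $p$ and $\lambda$ and a sequence of nonnegative functions $\{h_k\}_{k\ge1}$ in $L^p(d\eta_\lambda)$ such that $\|h_k\|_2=1$ for all $k$, $\delta_{\mathrm{BH}}(h_k)\to0$ and $\|h_k\|_{L^p(d\eta_\lambda)}\to\infty$ as $k\to\infty$, and $$\liminf_{k\to\infty}\frac{\mathrm{dist}_{L^p(d\eta_\lambda)}(h_k,\mathfrak{G})}{\|h_k\|_{L^p(d\eta_\lambda)}}\ge C(p,\lambda)>0.$$
   Context: All functions are on $\mathbb{R}$, and $\|\cdot\|_2$ is the $L^2$ norm with respect to Lebesgue measure. The Shannon entropy of a nonnegative function $\rho$ is $S(\rho)=-\int_{\mathbb{R}}\rho\log\rho\,dx$. For a nonnegative $h$ with $\|h\|_2=1$, the deficit of the Beckner–Hirschman inequality is $$\delta_{\mathrm{BH}}(h)=S(|h|^2)+S(|\widehat h|^2)-(1-\log2)\ge0,\qquad \widehat h(\xi)=\int_{\mathbb{R}}e^{-2\pi i x\xi}h(x)\,dx.$$ The set of nonnegative $L^2$-normalized optimizers (those $h$ with $\delta_{\mathrm{BH}}(h)=0$) is $$\mathfrak{G}=\left\{G_{a,r}(x)=\left(\tfrac{2a}{\pi}\right)^{1/4}e^{-a(x-r)^2}:a>0,\ r\in\mathbb{R}\right\}.$$ For a measure $\mu$ on $\mathbb{R}$ and $p>0$, $\mathrm{dist}_{L^p(d\mu)}(h,\mathfrak{G})=\inf_{u\in\mathfrak{G}}\|h-u\|_{L^p(d\mu)}=\inf_{a>0,\,r\in\mathbb{R}}\|h-G_{a,r}\|_{L^p(d\mu)}$.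 *)

theory Defs
  imports "HOL-Analysis.Analysis"
begin

definition Lp_space :: "'a measure \<Rightarrow> real \<Rightarrow> ('a \<Rightarrow> 'b::real_normed_vector) set" where
  "Lp_space M p = {f. f \<in> borel_measurable M \<and> integrable M (\<lambda>x. norm (f x) powr p)}"

text \<open>The norm is only meaningful on \<open>Lp_space M p\<close>: the Bochner integral of a
  non-integrable function is 0.\<close>

definition Lp_norm :: "'a measure \<Rightarrow> real \<Rightarrow> ('a \<Rightarrow> 'b::real_normed_vector) \<Rightarrow> real" where
  "Lp_norm M p f = (\<integral>x. norm (f x) powr p \<partial>M) powr (1 / p)"

definition eta :: "real \<Rightarrow> real measure" where
  "eta l = density lborel (\<lambda>x. ennreal (\<bar>x\<bar> powr l))"

text \<open>The entropy is extended-real valued, as the negative part minus the positive part of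
  \<open>\<integral>\<rho> log \<rho>\<close>, since either part may be infinite; \<open>ennreal\<close> truncates negative reals to 0.
  In the undefined case \<open>\<infinity> - \<infinity>\<close> the value is \<open>\<infinity>\<close>, so convergence of
  a deficit to a finite limit excludes it for all large indices.\<close>

definition shannon_entropy :: "(real \<Rightarrow> real) \<Rightarrow> ereal" where
  "shannon_entropy \<rho> =
     enn2ereal (\<integral>\<^sup>+x. ennreal (- (\<rho> x * ln (\<rho> x))) \<partial>lborel)
     - enn2ereal (\<integral>\<^sup>+x. ennreal (\<rho> x * ln (\<rho> x)) \<partial>lborel)"

definition fourier_integral :: "(real \<Rightarrow> complex) \<Rightarrow> real \<Rightarrow> complex" where
  "fourier_integral f \<xi> =
     (\<integral>x. exp (- 2 * of_real pi * \<i> * of_real x * of_real \<xi>) * f x \<partial>lborel)"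

text \<open>For integrable \<open>f\<close> the transform is the integral. For the remaining square-integrable
  \<open>f\<close> it is the Plancherel extension, the \<open>L\<^sup>2\<close> limit of the transforms of the truncations
  of \<open>f\<close> to \<open>[-n, n]\<close>; this limit is unique up to null sets, on which the entropy does not
  depend.\<close>

definition fourier :: "(real \<Rightarrow> complex) \<Rightarrow> real \<Rightarrow> complex" where
  "fourier f =
     (if integrable lborel f then fourier_integral f
      else (SOME g. g \<in> Lp_space lborel 2 \<and>
              (\<lambda>n::nat. Lp_norm lborel 2
                 (\<lambda>\<xi>. fourier_integral (\<lambda>x. indicator {- real n..real n} x * f x) \<xi> - g \<xi>))
              \<longlonglongrightarrow> 0))"

definition BH_deficit :: "(real \<Rightarrow> real) \<Rightarrow> ereal" where
  "BH_deficit h =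
     shannon_entropy (\<lambda>x. \<bar>h x\<bar>\<^sup>2)
     + shannon_entropy (\<lambda>\<xi>. (cmod (fourier (\<lambda>x. complex_of_real (h x)) \<xi>))\<^sup>2)
     - ereal (1 - ln 2)"

definition gauss :: "real \<Rightarrow> real \<Rightarrow> real \<Rightarrow> real" where
  "gauss a r x = (2 * a / pi) powr (1 / 4) * exp (- a * (x - r)\<^sup>2)"

definition gaussians :: "(real \<Rightarrow> real) set" where
  "gaussians = {gauss a r | a r. a > 0}"

definition Lp_dist :: "real measure \<Rightarrow> real \<Rightarrow> (real \<Rightarrow> real) \<Rightarrow> (real \<Rightarrow> real) set \<Rightarrow> real" where
  "Lp_dist M p h U = (INF u\<in>U. Lp_norm M p (\<lambda>x. h x - u x))"

end

theory Submission
  imports Defs "HOL-Probability.Probability"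
begin

text \<open>Write \<open>g = G\<^bsub>\<pi>,0\<^esub>\<close>. The sequence is the \<open>L\<^sup>2\<close>-normalization of
  \<open>g(x) + \<epsilon> (g(x - R) + g(x + R))\<close> with \<open>\<epsilon> \<rightarrow> 0\<close> and \<open>R \<rightarrow> \<infinity>\<close> so fast that \<open>\<epsilon> R\<^bsup>\<lambda>/p\<^esup> \<rightarrow> \<infinity>\<close>. Its Fourier
  transform is a multiple of \<open>g(\<xi>) (1 + 2\<epsilon> cos(2\<pi>R\<xi>))\<close>, so in both variables the amplitude tends to
  \<open>g\<close> in \<open>L\<^sup>1\<close> at rate \<open>\<epsilon>\<close>, whatever \<open>R\<close> is, and the deficit tends to that of \<open>g\<close>, which is 0. The
  weighted norm is of order \<open>\<epsilon> R\<^bsup>\<lambda>/p\<^esup>\<close>, carried by the bumps. A Gaussian is unimodal, so it cannot follow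
  both bumps and also the gap between them; hence its weighted distance to the function is of the
  same order.\<close>

section \<open>Entropy of bounded integrable amplitudes\<close>

text \<open>The map \<open>s \<mapsto> s\<^sup>2 ln (s\<^sup>2)\<close>, unlike \<open>t \<mapsto> t ln t\<close>, is Lipschitz up to 0. Therefore \<open>L\<^sup>1\<close> convergence
  of bounded amplitudes already gives convergence of entropies.\<close>

lemma mult_ln_lipschitz:
  fixes s t S :: real
  assumes "0 \<le> s" "s \<le> S" "0 \<le> t" "t \<le> S"
  shows "\<bar>s\<^sup>2 * ln (s\<^sup>2) - t\<^sup>2 * ln (t\<^sup>2)\<bar> \<le> (4 * (1 + S\<^sup>2) + 2 * S) * \<bar>s - t\<bar>"
proof -
  \<comment> \<open>For ordered arguments the increment is split into twice
    \<open>(t + s) * ln t * (t - s)\<close> and twice \<open>s\<^sup>2 * (ln t - ln s)\<close>. In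
    the first, \<open>t + s \<le> 2 * t\<close> trades the unbounded logarithm for the bounded
    \<open>t * ln t\<close>; in the second, ln(t/s) \<le> t/s - 1 cancels one factor
    \<open>s\<close>.\<close>
  have aux: "\<bar>t\<^sup>2 * ln (t\<^sup>2) - s\<^sup>2 * ln (s\<^sup>2)\<bar> \<le> (4 * (1 + S\<^sup>2) + 2 * S) * (t - s)"
    if st: "0 \<le> s" "s < t" "t \<le> S" for s t :: real
  proof -
    have t: "t > 0" and S: "S > 0" using st by auto
    \<comment> \<open>Below 1 the bound is 1, above 1 it is \<open>S\<^sup>2\<close>; the sum covers
      both cases.\<close>
    have tl: "\<bar>t * ln t\<bar> \<le> 1 + S\<^sup>2"
    proof (cases "t \<le> 1")
      case True
      have "- ln t \<le> 1 / t - 1"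
        using ln_le_minus_one[of "1 / t"] t by (simp add: ln_div)
      then have "t * (- ln t) \<le> t * (1 / t - 1)" using t by (intro mult_left_mono) auto
      also have "\<dots> \<le> 1" using t by (simp add: field_simps)
      finally have "- (t * ln t) \<le> 1" by simp
      moreover have "t * ln t \<le> 0" using True t by (simp add: mult_nonneg_nonpos)
      moreover have "0 \<le> S\<^sup>2" by simp
      ultimately show ?thesis by linarith
    next
      case False
      then have "\<bar>t * ln t\<bar> = t * ln t" by simp
      also have "\<dots> \<le> t * t" using t ln_le_minus_one[of t] by (intro mult_left_mono) auto
      also have "\<dots> \<le> S\<^sup>2" using st t by (simp add: power2_eq_square mult_mono)
      finally show ?thesis by simp
    qed
    have sl: "\<bar>s\<^sup>2 * (ln t - ln s)\<bar> \<le> S * (t - s)"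
    proof (cases "s = 0")
      case True
      then show ?thesis using S st by simp
    next
      case False
      then have s: "s > 0" using st by simp
      have "ln t - ln s = ln (t / s)" using s t by (simp add: ln_div)
      also have "\<dots> \<le> (t - s) / s"
        using ln_le_minus_one[of "t / s"] s t by (simp add: diff_divide_distrib)
      finally have "s\<^sup>2 * (ln t - ln s) \<le> s\<^sup>2 * ((t - s) / s)" by (intro mult_left_mono) auto
      also have "\<dots> = s * (t - s)" using s by (simp add: power2_eq_square)
      also have "\<dots> \<le> S * (t - s)" using st by (intro mult_right_mono) auto
      finally have "s\<^sup>2 * (ln t - ln s) \<le> S * (t - s)" .
      moreover have "s\<^sup>2 * (ln t - ln s) \<ge> 0" using s st by simp
      ultimately show ?thesis by linarith
    qed
    have "\<bar>(t + s) * ln t\<bar> = (t + s) * \<bar>ln t\<bar>" using st by (simp add: abs_mult)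
    also have "\<dots> \<le> (2 * t) * \<bar>ln t\<bar>" using st by (intro mult_right_mono) auto
    also have "\<dots> = 2 * \<bar>t * ln t\<bar>" using t by (simp add: abs_mult)
    also have "\<dots> \<le> 2 * (1 + S\<^sup>2)" using tl by simp
    finally have "\<bar>(t + s) * ln t\<bar> * (t - s) \<le> 2 * (1 + S\<^sup>2) * (t - s)"
      using st by (intro mult_right_mono) auto
    then have tl': "\<bar>(t + s) * ln t * (t - s)\<bar> \<le> 2 * (1 + S\<^sup>2) * (t - s)"
      using st by (simp add: abs_mult)
    have "t\<^sup>2 * ln (t\<^sup>2) - s\<^sup>2 * ln (s\<^sup>2)
        = 2 * ((t + s) * ln t * (t - s)) + 2 * (s\<^sup>2 * (ln t - ln s))"
    proof -
      have "ln (t\<^sup>2) = 2 * ln t" "s \<noteq> 0 \<Longrightarrow> ln (s\<^sup>2) = 2 * ln s"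
        using t st by (auto simp: ln_realpow)
      then show ?thesis
        by (cases "s = 0") (simp_all add: power2_eq_square algebra_simps)
    qed
    then have "\<bar>t\<^sup>2 * ln (t\<^sup>2) - s\<^sup>2 * ln (s\<^sup>2)\<bar>
        \<le> 2 * (2 * (1 + S\<^sup>2) * (t - s)) + 2 * (S * (t - s))"
      using tl' sl by linarith
    then show ?thesis by (simp add: algebra_simps)
  qed
  show ?thesis
    using aux[of s t] aux[of t s] assms by (cases s t rule: linorder_cases) (auto simp: abs_minus_commute)
qed

text \<open>The Lipschitz estimate against amplitude 0, where the expression vanishes, dominates the
  integrand by a multiple of \<open>s\<close>.\<close>

lemma integrable_mult_ln:
  fixes s :: "real \<Rightarrow> real"
  assumes s: "integrable lborel s" and S: "\<And>x. 0 \<le> s x" "\<And>x. s x \<le> S"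
  shows "integrable lborel (\<lambda>x. (s x)\<^sup>2 * ln ((s x)\<^sup>2))"
proof (rule Bochner_Integration.integrable_bound)
  show "integrable lborel (\<lambda>x. (4 * (1 + S\<^sup>2) + 2 * S) * s x)" using s by simp
  have [measurable]: "s \<in> borel_measurable lborel" using s by simp
  show "(\<lambda>x. (s x)\<^sup>2 * ln ((s x)\<^sup>2)) \<in> borel_measurable lborel" by measurable
  show "AE x in lborel. norm ((s x)\<^sup>2 * ln ((s x)\<^sup>2)) \<le> norm ((4 * (1 + S\<^sup>2) + 2 * S) * s x)"
  proof (rule AE_I2)
    fix x
    have "0 \<le> S" using S[of x] by linarith
    then show "norm ((s x)\<^sup>2 * ln ((s x)\<^sup>2)) \<le> norm ((4 * (1 + S\<^sup>2) + 2 * S) * s x)"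
      using mult_ln_lipschitz[of "s x" S 0] S[of x] by (simp add: abs_mult)
  qed
qed

text \<open>Integrability makes both extended parts finite, so the convention for infinity minus
  infinity never enters and deficits can be computed in the reals.\<close>

lemma shannon_entropy_eq_integral:
  assumes "integrable lborel (\<lambda>x. \<rho> x * ln (\<rho> x))"
  shows "shannon_entropy \<rho> = ereal (- (\<integral>x. \<rho> x * ln (\<rho> x) \<partial>lborel))"
proof -
  let ?f = "\<lambda>x. \<rho> x * ln (\<rho> x)"
  have m[measurable]: "?f \<in> borel_measurable lborel" using assms by simp
  have f: "(\<integral>\<^sup>+x. ennreal (?f x) \<partial>lborel) < \<infinity>" "(\<integral>\<^sup>+x. ennreal (- ?f x) \<partial>lborel) < \<infinity>"
    using assms by (auto simp: real_integrable_def top.not_eq_extremum)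
  have "enn2ereal a - enn2ereal b = ereal (enn2real a - enn2real b)"
    if "a < \<infinity>" "b < \<infinity>" for a b :: ennreal
    using that by (cases a; cases b) auto
  then show ?thesis
    unfolding shannon_entropy_def real_lebesgue_integral_def[OF assms] using f by simp
qed

lemma entropy_integral_tendsto:
  fixes s :: "nat \<Rightarrow> real \<Rightarrow> real" and g :: "real \<Rightarrow> real"
  assumes s: "\<And>k. integrable lborel (s k)" "\<And>k x. 0 \<le> s k x" "\<And>k x. s k x \<le> S"
    and g: "integrable lborel g" "\<And>x. 0 \<le> g x" "\<And>x. g x \<le> S"
    and lim: "(\<lambda>k. \<integral>x. \<bar>s k x - g x\<bar> \<partial>lborel) \<longlonglongrightarrow> 0"
  shows "(\<lambda>k. \<integral>x. (s k x)\<^sup>2 * ln ((s k x)\<^sup>2) \<partial>lborel) \<longlonglongrightarrow> (\<integral>x. (g x)\<^sup>2 * ln ((g x)\<^sup>2) \<partial>lborel)"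
proof -
  let ?K = "4 * (1 + S\<^sup>2) + 2 * S"
  let ?F = "\<lambda>t::real. t\<^sup>2 * ln (t\<^sup>2)"
  have F: "integrable lborel (\<lambda>x. ?F (s k x))" "integrable lborel (\<lambda>x. ?F (g x))" for k
    using integrable_mult_ln[OF s(1,2,3)] integrable_mult_ln[OF g] by auto
  have "norm ((\<integral>x. ?F (s k x) \<partial>lborel) - (\<integral>x. ?F (g x) \<partial>lborel))
      \<le> ?K * (\<integral>x. \<bar>s k x - g x\<bar> \<partial>lborel)" for k
  proof -
    have "norm ((\<integral>x. ?F (s k x) \<partial>lborel) - (\<integral>x. ?F (g x) \<partial>lborel))
        = norm (\<integral>x. ?F (s k x) - ?F (g x) \<partial>lborel)"
      using F by (subst Bochner_Integration.integral_diff) auto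
    also have "\<dots> \<le> (\<integral>x. norm (?F (s k x) - ?F (g x)) \<partial>lborel)" by (rule integral_norm_bound)
    also have "\<dots> \<le> (\<integral>x. ?K * \<bar>s k x - g x\<bar> \<partial>lborel)"
      using F s g mult_ln_lipschitz[OF s(2,3) g(2,3)] by (intro integral_mono) auto
    finally show ?thesis by simp
  qed
  moreover have "(\<lambda>k. ?K * (\<integral>x. \<bar>s k x - g x\<bar> \<partial>lborel)) \<longlonglongrightarrow> 0"
    using tendsto_mult_right_zero[OF lim] by blast
  ultimately have "(\<lambda>k. (\<integral>x. ?F (s k x) \<partial>lborel) - (\<integral>x. ?F (g x) \<partial>lborel)) \<longlonglongrightarrow> 0"
    by (rule Lim_null_comparison[OF always_eventually[OF allI]])
  then show ?thesis using LIM_zero_iff by blast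
qed

section \<open>Gaussians\<close>

lemma gauss_nonneg: "0 \<le> gauss a r x"
  by (simp add: gauss_def)

lemma borel_measurable_gauss[measurable]: "gauss a r \<in> borel_measurable borel"
  unfolding gauss_def[abs_def] by measurable

lemma gauss_shift: "gauss a r x = gauss a 0 (x - r)"
  by (simp add: gauss_def)

text \<open>Either \<open>x\<close> lies between \<open>y\<close> and the centre or between the
  centre and \<open>z\<close>, so it is at least as close to the centre as one of the endpoints.
  This is the only feature of Gaussians that separates them from the two-bump function.\<close>

lemma gauss_unimodal:
  assumes "a \<ge> 0" "y \<le> x" "x \<le> z"
  shows "min (gauss a r y) (gauss a r z) \<le> gauss a r x"
proof (cases "x \<le> r")
  case True
  then have "(x - r)\<^sup>2 \<le> (y - r)\<^sup>2" using assms by (simp add: abs_le_square_iff[symmetric])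
  then have "gauss a r y \<le> gauss a r x" using assms by (simp add: gauss_def mult_left_mono)
  then show ?thesis by simp
next
  case False
  then have "(x - r)\<^sup>2 \<le> (z - r)\<^sup>2" using assms by (simp add: abs_le_square_iff[symmetric])
  then have "gauss a r z \<le> gauss a r x" using assms by (simp add: gauss_def mult_left_mono)
  then show ?thesis by simp
qed

lemma gauss_square_normal_density:
  assumes "a > 0"
  shows "(gauss a r x)\<^sup>2 = normal_density r (1 / (2 * sqrt a)) x"
proof -
  have "(gauss a r x)\<^sup>2 = ((2 * a / pi) powr (1 / 4))\<^sup>2 * exp (- (2 * a * (x - r)\<^sup>2))"
    by (simp add: gauss_def power_mult_distrib exp_double[symmetric] algebra_simps)
  also have "((2 * a / pi) powr (1 / 4))\<^sup>2 = sqrt (2 * a / pi)"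
    using assms by (simp add: powr_power powr_half_sqrt)
  finally show ?thesis
    using assms by (simp add: normal_density_def power_divide power_mult_distrib real_sqrt_divide real_sqrt_mult field_simps)
qed

lemma gauss_normal_density:
  assumes "a > 0"
  shows "gauss a r x = (2 * pi / a) powr (1 / 4) * normal_density r (1 / sqrt (2 * a)) x"
proof -
  \<comment> \<open>The factor \<open>(a / pi) powr (1 / 2)\<close> is the prefactor of the normal
    density of variance 1/(2a).\<close>
  have "(2 * a / pi) powr (1 / 4) = (2 * pi / a) powr (1 / 4) * (a / pi) powr (1 / 2)"
  proof -
    have "(a / pi) powr (1 / 2) = ((a / pi) powr 2) powr (1 / 4)" by (simp add: powr_powr)
    also have "\<dots> = ((a / pi)^2) powr (1 / 4)" using assms by (simp add: powr_numeral)
    finally have "(2 * pi / a) powr (1 / 4) * (a / pi) powr (1 / 2) = (2 * pi / a * (a / pi)^2) powr (1 / 4)"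
      using assms by (simp add: powr_mult[symmetric])
    also have "2 * pi / a * (a / pi)^2 = 2 * a / pi" using assms by (simp add: power2_eq_square)
    finally show ?thesis by simp
  qed
  then show ?thesis
    using assms by (simp add: gauss_def normal_density_def power_divide real_sqrt_divide powr_half_sqrt field_simps)
qed

lemma integrable_gauss[simp]:
  assumes "a > 0"
  shows "integrable lborel (gauss a r)"
  unfolding gauss_normal_density[OF assms, abs_def] using assms by simp

lemma integrable_gauss_square[simp]:
  assumes "a > 0"
  shows "integrable lborel (\<lambda>x. (gauss a r x)\<^sup>2)"
  unfolding gauss_square_normal_density[OF assms] using assms by simp

lemma integral_gauss_square:
  assumes "a > 0"
  shows "(\<integral>x. (gauss a r x)\<^sup>2 \<partial>lborel) = 1"
  unfolding gauss_square_normal_density[OF assms] using assms by simp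

lemma integral_gauss_shift: "(\<integral>x. gauss a r x \<partial>lborel) = (\<integral>x. gauss a 0 x \<partial>lborel)"
  using lborel_integral_real_affine[of 1 "gauss a 0" "-r"] by (simp add: gauss_shift[of a r])

text \<open>The logarithm of a squared Gaussian is quadratic, so only mass and variance enter. Minus
  twice this value is \<open>1 - ln 2\<close>, and since \<open>gauss pi 0\<close> is its own
  Fourier transform, its deficit is 0.\<close>

lemma integral_gauss_entropy:
  "(\<integral>x. (gauss pi 0 x)\<^sup>2 * ln ((gauss pi 0 x)\<^sup>2) \<partial>lborel) = (ln 2 - 1) / 2"
proof -
  let ?n = "normal_density 0 (1 / (2 * sqrt pi))"
  have s: "0 < 1 / (2 * sqrt pi)" by simp
  have "ln ((gauss pi 0 x)\<^sup>2) = ln 2 / 2 - 2 * pi * x\<^sup>2" for x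
    by (simp add: gauss_def ln_realpow ln_mult ln_powr)
  then have "(\<lambda>x. (gauss pi 0 x)\<^sup>2 * ln ((gauss pi 0 x)\<^sup>2))
      = (\<lambda>x. (gauss pi 0 x)\<^sup>2 * (ln 2 / 2 - 2 * pi * x\<^sup>2))"
    by simp
  also have "\<dots> = (\<lambda>x. ln 2 / 2 * ?n x - 2 * pi * (?n x * (x - 0) ^ (2 * 1)))"
    unfolding gauss_square_normal_density[OF pi_gt_zero]
    by (simp add: power2_eq_square algebra_simps)
  finally have "(\<lambda>x. (gauss pi 0 x)\<^sup>2 * ln ((gauss pi 0 x)\<^sup>2))
      = (\<lambda>x. ln 2 / 2 * ?n x - 2 * pi * (?n x * (x - 0) ^ (2 * 1)))" .
  then have "(\<integral>x. (gauss pi 0 x)\<^sup>2 * ln ((gauss pi 0 x)\<^sup>2) \<partial>lborel)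
     = ln 2 / 2 * (\<integral>x. ?n x \<partial>lborel) - 2 * pi * (\<integral>x. ?n x * (x - 0) ^ (2 * 1) \<partial>lborel)"
    using integrable_normal_moment[OF s, of 0 "2 * 1"]
    by (simp only: Bochner_Integration.integral_diff integral_mult_right_zero integrable_mult_right integrable_normal_density s)
  \<comment> \<open>The variance is 1/(4 pi), and \<open>2 * pi\<close> times it is 1/2.\<close>
  also have "\<dots> = ln 2 / 2 - 1 / 2"
    using integral_normal_moment_even[OF s, of 0 1] by (simp add: power_divide power_mult_distrib)
  finally show ?thesis by (simp add: field_simps)
qed

text \<open>This is the characteristic function of the standard normal law at
  \<open>- sqrt (2 * pi) * \<xi>\<close>, after the substitution y = sqrt(2 pi) (x - r). The
  Jacobian cancels the prefactor of the density, and the shift by \<open>r\<close> leaves only a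
  phase.\<close>

lemma fourier_integral_gauss:
  "fourier_integral (\<lambda>x. complex_of_real (gauss pi r x)) \<xi>
    = exp (- 2 * of_real pi * \<i> * of_real r * of_real \<xi>) * of_real (gauss pi 0 \<xi>)"
proof -
  let ?q = "sqrt (2 * pi)"
  have q: "?q > 0" "?q * ?q = 2 * pi" by auto
  let ?e = "\<lambda>t y::real. exp (\<i> * complex_of_real (t * y))"
  have "char std_normal_distribution (- ?q * \<xi>)
      = (\<integral>y. std_normal_density y *\<^sub>R ?e (- ?q * \<xi>) y \<partial>lborel)"
    unfolding char_def by (subst integral_density) auto
  also have "\<dots> = ?q *\<^sub>R (\<integral>x. std_normal_density (- ?q * r + ?q * x) *\<^sub>R ?e (- ?q * \<xi>) (- ?q * r + ?q * x) \<partial>lborel)"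
    using q by (subst lborel_integral_real_affine[of ?q _ "- ?q * r"]) auto
  also have "\<dots> = (\<integral>x. (?q * std_normal_density (- ?q * r + ?q * x)) *\<^sub>R ?e (- ?q * \<xi>) (- ?q * r + ?q * x) \<partial>lborel)"
    by (subst integral_scaleR_right[symmetric]) simp
  also have "\<dots> = (\<integral>x. exp (2 * of_real pi * \<i> * of_real r * of_real \<xi>) *
     (exp (- 2 * of_real pi * \<i> * of_real x * of_real \<xi>) * exp (- pi * (x - r)\<^sup>2)) \<partial>lborel)"
  proof (rule Bochner_Integration.integral_cong[OF refl])
    fix x :: real
    have e: "- ?q * r + ?q * x = ?q * (x - r)" by (simp add: algebra_simps)
    have 1: "?q * std_normal_density (- ?q * r + ?q * x) = exp (- pi * (x - r)\<^sup>2)"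
      unfolding e by (simp add: std_normal_density_def power_mult_distrib)
    have "- ?q * \<xi> * (?q * (x - r)) = - (?q * ?q) * \<xi> * (x - r)" by (simp only: algebra_simps)
    then have 2: "- ?q * \<xi> * (- ?q * r + ?q * x) = - (2 * pi) * \<xi> * (x - r)"
      unfolding e q .
    show "(?q * std_normal_density (- ?q * r + ?q * x)) *\<^sub>R ?e (- ?q * \<xi>) (- ?q * r + ?q * x) =
       exp (2 * of_real pi * \<i> * of_real r * of_real \<xi>) *
     (exp (- 2 * of_real pi * \<i> * of_real x * of_real \<xi>) * exp (- pi * (x - r)\<^sup>2))"
      unfolding 1 2 mult_exp_exp mult.assoc[symmetric] scaleR_conv_of_real 
      by (simp add: algebra_simps exp_add[symmetric] exp_diff)
  qed
  also have "\<dots> = exp (2 * of_real pi * \<i> * of_real r * of_real \<xi>) *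
     (\<integral>x. exp (- 2 * of_real pi * \<i> * of_real x * of_real \<xi>) * exp (- pi * (x - r)\<^sup>2) \<partial>lborel)"
    by simp
  finally have *: "(\<integral>x. exp (- 2 * of_real pi * \<i> * of_real x * of_real \<xi>) * exp (- pi * (x - r)\<^sup>2) \<partial>lborel)
     = exp (- 2 * of_real pi * \<i> * of_real r * of_real \<xi>) * exp (- pi * \<xi>\<^sup>2)"
    by (simp add: char_std_normal_distribution power_mult_distrib exp_minus field_simps)
  have "fourier_integral (\<lambda>x. complex_of_real (gauss pi r x)) \<xi> =
     (\<integral>x. of_real (2 powr (1 / 4)) * (exp (- 2 * of_real pi * \<i> * of_real x * of_real \<xi>) * exp (- pi * (x - r)\<^sup>2)) \<partial>lborel)"
    unfolding fourier_integral_def by (simp add: gauss_def exp_of_real algebra_simps)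
  also have "\<dots> = of_real (2 powr (1 / 4)) * (exp (- 2 * of_real pi * \<i> * of_real r * of_real \<xi>) * exp (- pi * \<xi>\<^sup>2))"
    unfolding integral_mult_right_zero * ..
  finally show ?thesis by (simp add: gauss_def)
qed

section \<open>Weighted Lebesgue spaces\<close>

lemma powr_add_le:
  fixes x y p :: real
  assumes "0 \<le> x" "0 \<le> y" "0 \<le> p"
  shows "(x + y) powr p \<le> 2 powr p * (x powr p + y powr p)"
proof -
  have "(x + y) powr p \<le> (2 * max x y) powr p" using assms by (intro powr_mono2) auto
  also have "\<dots> = 2 powr p * max x y powr p" using assms by (simp add: powr_mult)
  also have "\<dots> \<le> 2 powr p * (x powr p + y powr p)"
    by (intro mult_left_mono) (auto simp: max_def)
  finally show ?thesis .
qed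

lemma Lp_space_add:
  fixes f g :: "'a \<Rightarrow> real"
  assumes "f \<in> Lp_space M p" "g \<in> Lp_space M p" "0 \<le> p"
  shows "(\<lambda>x. f x + g x) \<in> Lp_space M p"
proof -
  have [measurable]: "f \<in> borel_measurable M" "g \<in> borel_measurable M"
    using assms by (auto simp: Lp_space_def)
  have "integrable M (\<lambda>x. norm (f x + g x) powr p)"
  proof (rule Bochner_Integration.integrable_bound)
    show "integrable M (\<lambda>x. 2 powr p * (norm (f x) powr p + norm (g x) powr p))"
      using assms by (simp add: Lp_space_def)
    have "norm (f x + g x) powr p \<le> 2 powr p * (norm (f x) powr p + norm (g x) powr p)" for x
      using powr_add_le[of "norm (f x)" "norm (g x)" p] assms(3)
        powr_mono2[OF assms(3) _ norm_triangle_ineq[of "f x" "g x"]] by simp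
    then show "AE x in M. norm (norm (f x + g x) powr p)
        \<le> norm (2 powr p * (norm (f x) powr p + norm (g x) powr p))"
      by (intro AE_I2) (simp add: abs_mult)
  qed measurable
  then show ?thesis by (simp add: Lp_space_def)
qed

lemma Lp_space_mult:
  fixes f :: "'a \<Rightarrow> real"
  assumes "f \<in> Lp_space M p"
  shows "(\<lambda>x. c * f x) \<in> Lp_space M p"
  using assms by (auto simp: Lp_space_def abs_mult powr_mult)

lemma Lp_space_diff:
  fixes f g :: "'a \<Rightarrow> real"
  assumes "f \<in> Lp_space M p" "g \<in> Lp_space M p" "0 \<le> p"
  shows "(\<lambda>x. f x - g x) \<in> Lp_space M p"
  using Lp_space_add[OF assms(1) Lp_space_mult[OF assms(2), of "-1"] assms(3)] by simp

lemma sets_eta[measurable_cong, simp]: "sets (eta l) = sets borel"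
  by (simp add: eta_def)

lemma Lp_space_eta_iff:
  fixes f :: "real \<Rightarrow> real"
  shows "f \<in> Lp_space (eta l) p \<longleftrightarrow>
    f \<in> borel_measurable borel \<and> integrable lborel (\<lambda>x. \<bar>x\<bar> powr l * \<bar>f x\<bar> powr p)"
proof -
  have "integrable (eta l) (\<lambda>x. \<bar>f x\<bar> powr p) \<longleftrightarrow> integrable lborel (\<lambda>x. \<bar>x\<bar> powr l * \<bar>f x\<bar> powr p)"
    if [measurable]: "f \<in> borel_measurable borel"
    unfolding eta_def by (subst integrable_density) auto
  moreover have "borel_measurable (eta l) = borel_measurable borel"
    by (rule measurable_cong_sets) auto
  ultimately show ?thesis by (auto simp: Lp_space_def)
qed

lemma Lp_norm_eta:
  fixes f :: "real \<Rightarrow> real"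
  assumes [measurable]: "f \<in> borel_measurable borel"
  shows "Lp_norm (eta l) p f = (\<integral>x. \<bar>x\<bar> powr l * \<bar>f x\<bar> powr p \<partial>lborel) powr (1 / p)"
  unfolding Lp_norm_def eta_def by (subst integral_density) auto

text \<open>Every lower bound on a weighted norm below comes from one window on which both function
  and weight are bounded below. Membership in \<open>Lp_space\<close> is essential, because the
  integral of a non-integrable function is 0.\<close>

lemma Lp_norm_eta_ge_interval:
  fixes f :: "real \<Rightarrow> real"
  assumes f: "f \<in> Lp_space (eta l) p" and nn: "0 \<le> l" "0 < p" "0 \<le> m" "0 \<le> w" "0 \<le> d"
    and lb: "\<And>x. x \<in> {s..s + d} \<Longrightarrow> m \<le> \<bar>f x\<bar>" "\<And>x. x \<in> {s..s + d} \<Longrightarrow> w \<le> \<bar>x\<bar>"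
  shows "m * (d * w powr l) powr (1 / p) \<le> Lp_norm (eta l) p f"
proof -
  have [measurable]: "f \<in> borel_measurable borel"
    and int: "integrable lborel (\<lambda>x. \<bar>x\<bar> powr l * \<bar>f x\<bar> powr p)"
    using f by (auto simp: Lp_space_eta_iff)
  have "d * w powr l * m powr p = (\<integral>x. indicator {s..s + d} x * (w powr l * m powr p) \<partial>lborel)"
    using nn by simp
  also have "\<dots> \<le> (\<integral>x. \<bar>x\<bar> powr l * \<bar>f x\<bar> powr p \<partial>lborel)"
  proof (rule integral_mono[OF _ int])
    show "integrable lborel (\<lambda>x. indicator {s..s + d} x * (w powr l * m powr p))"
      using nn by (intro integrable_mult_left integrable_real_indicator) auto
    show "indicator {s..s + d} x * (w powr l * m powr p) \<le> \<bar>x\<bar> powr l * \<bar>f x\<bar> powr p" for x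
      using lb[of x] nn by (auto simp: indicator_def intro!: mult_mono powr_mono2)
  qed
  finally have "(d * w powr l * m powr p) powr (1 / p) \<le> Lp_norm (eta l) p f"
    using nn by (subst Lp_norm_eta) (auto intro!: powr_mono2)
  also have "(d * w powr l * m powr p) powr (1 / p) = m * (d * w powr l) powr (1 / p)"
    using nn by (simp add: powr_mult powr_powr)
  finally show ?thesis .
qed

text \<open>The \<open>p\<close>-th power of a Gaussian has exponent
  \<open>2 * b * (x - r)\<^sup>2\<close>; half of it absorbs the polynomial weight, and the other
  half remains as an integrable Gaussian of parameter \<open>b\<close>.\<close>

lemma integrable_weight_gauss:
  assumes "a > 0" "p > 0" "l \<ge> 0"
  shows "integrable lborel (\<lambda>x. (1 + \<bar>x\<bar>) powr l * gauss a r x powr p)"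
proof -
  define b where "b = p * a / 2"
  have b: "b > 0" using assms by (simp add: b_def)
  define K where "K = exp (l * \<bar>r\<bar> + l\<^sup>2 / (4 * b)) * ((2 * a / pi) powr (1 / 4)) powr p / (2 * b / pi) powr (1 / 4)"
  have bound: "(1 + \<bar>x\<bar>) powr l * gauss a r x powr p \<le> K * gauss b r x" for x
  proof -
    \<comment> \<open>Completing the square bounds the linear term by the quadratic one plus a
      constant, which goes into \<open>K\<close>.\<close>
    have "l * \<bar>x - r\<bar> \<le> b * (x - r)\<^sup>2 + l\<^sup>2 / (4 * b)"
    proof -
      have "0 \<le> (2 * b * \<bar>x - r\<bar> - l)\<^sup>2 / (4 * b)" using b by simp
      also have "\<dots> = b * (x - r)\<^sup>2 + l\<^sup>2 / (4 * b) - l * \<bar>x - r\<bar>"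
        using b by (simp add: power2_eq_square field_simps)
      finally show ?thesis by simp
    qed
    moreover have "l * ln (1 + \<bar>x\<bar>) \<le> l * (\<bar>r\<bar> + \<bar>x - r\<bar>)"
      using ln_add_one_self_le_self[of "\<bar>x\<bar>"] assms by (intro mult_left_mono) auto
    ultimately have "l * ln (1 + \<bar>x\<bar>) \<le> l * \<bar>r\<bar> + l\<^sup>2 / (4 * b) + b * (x - r)\<^sup>2"
      by (simp add: algebra_simps)
    moreover have "(1 + \<bar>x\<bar>) powr l = exp (l * ln (1 + \<bar>x\<bar>))" by (simp add: powr_def)
    ultimately have "(1 + \<bar>x\<bar>) powr l \<le> exp (l * \<bar>r\<bar> + l\<^sup>2 / (4 * b)) * exp (b * (x - r)\<^sup>2)"
      by (simp add: exp_add[symmetric])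
    then have "(1 + \<bar>x\<bar>) powr l * gauss a r x powr p
      \<le> exp (l * \<bar>r\<bar> + l\<^sup>2 / (4 * b)) * exp (b * (x - r)\<^sup>2) * gauss a r x powr p"
      by (intro mult_right_mono) auto
    also have "\<dots> = K * gauss b r x"
    proof -
      have "gauss a r x powr p = ((2 * a / pi) powr (1 / 4)) powr p * exp (- (2 * b * (x - r)\<^sup>2))"
        using assms by (simp add: gauss_def powr_mult exp_powr_real b_def algebra_simps)
      moreover have "exp (- (2 * b * (x - r)\<^sup>2)) = exp (- (b * (x - r)\<^sup>2)) * exp (- (b * (x - r)\<^sup>2))"
        by (simp add: exp_add[symmetric])
      ultimately show ?thesis
        using b by (simp add: K_def gauss_def exp_minus field_simps)
    qed
    finally show ?thesis .
  qed
  show ?thesis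
  proof (rule Bochner_Integration.integrable_bound)
    show "integrable lborel (\<lambda>x. K * gauss b r x)" using b by simp
    show "AE x in lborel. norm ((1 + \<bar>x\<bar>) powr l * gauss a r x powr p) \<le> norm (K * gauss b r x)"
      using bound by (intro AE_I2) (simp add: abs_of_nonneg order_trans[OF _ abs_ge_self])
  qed measurable
qed

lemma integrable_abs_powr_gauss:
  assumes "a > 0" "p > 0" "l \<ge> 0"
  shows "integrable lborel (\<lambda>x. \<bar>x\<bar> powr l * gauss a r x powr p)"
proof (rule Bochner_Integration.integrable_bound[OF integrable_weight_gauss[OF assms]])
  show "AE x in lborel. norm (\<bar>x\<bar> powr l * gauss a r x powr p) \<le> norm ((1 + \<bar>x\<bar>) powr l * gauss a r x powr p)"
    using assms by (intro AE_I2) (auto simp: abs_mult intro!: mult_right_mono powr_mono2)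
qed measurable

lemma gauss_in_Lp_space_eta:
  assumes "a > 0" "p > 0" "l \<ge> 0"
  shows "gauss a r \<in> Lp_space (eta l) p"
  using integrable_abs_powr_gauss[OF assms] by (simp add: Lp_space_eta_iff gauss_nonneg)

text \<open>After recentring, |r + x| \<le> R (1 + |x|), so a bump within distance \<open>R\<close>
  of the origin costs \<open>R powr l\<close> times a fixed integral. The case \<open>R = 1\<close>,
  \<open>r = 0\<close> serves the central Gaussian.\<close>

lemma integral_abs_powr_gauss_le:
  assumes "p > 0" "l \<ge> 0" "R \<ge> 1" "\<bar>r\<bar> \<le> R"
  shows "(\<integral>x. \<bar>x\<bar> powr l * gauss pi r x powr p \<partial>lborel)
    \<le> R powr l * (\<integral>x. (1 + \<bar>x\<bar>) powr l * gauss pi 0 x powr p \<partial>lborel)"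
proof -
  let ?f = "\<lambda>x. \<bar>x\<bar> powr l * gauss pi r x powr p"
  have "(\<integral>x. ?f x \<partial>lborel) = (\<integral>x. ?f (r + x) \<partial>lborel)"
    using lborel_integral_real_affine[of 1 ?f r] by simp
  also have "\<dots> \<le> (\<integral>x. R powr l * ((1 + \<bar>x\<bar>) powr l * gauss pi 0 x powr p) \<partial>lborel)"
  proof (rule integral_mono)
    have "integrable lborel ?f" using assms by (intro integrable_abs_powr_gauss) auto
    from lborel_integrable_real_affine[OF this, of 1 r] show "integrable lborel (\<lambda>x. ?f (r + x))" by simp
    show "integrable lborel (\<lambda>x. R powr l * ((1 + \<bar>x\<bar>) powr l * gauss pi 0 x powr p))"
      using assms by (intro integrable_mult_right integrable_weight_gauss) auto
    fix x :: real
    have "\<bar>x\<bar> \<le> R * \<bar>x\<bar>" using assms by (simp add: mult_le_cancel_right1)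
    then have "\<bar>r + x\<bar> \<le> R * (1 + \<bar>x\<bar>)" using assms by (simp add: algebra_simps)
    then have "\<bar>r + x\<bar> powr l \<le> (R * (1 + \<bar>x\<bar>)) powr l" using assms by (intro powr_mono2) auto
    also have "\<dots> = R powr l * (1 + \<bar>x\<bar>) powr l" using assms by (simp add: powr_mult)
    finally show "?f (r + x) \<le> R powr l * ((1 + \<bar>x\<bar>) powr l * gauss pi 0 x powr p)"
      by (simp add: gauss_shift[of pi r] mult_right_mono mult.assoc[symmetric])
  qed
  finally show ?thesis by simp
qed

section \<open>A Gaussian with two distant bumps\<close>

definition bumps :: "real \<Rightarrow> real \<Rightarrow> real \<Rightarrow> real" where
  "bumps e R x = gauss pi 0 x + e * (gauss pi R x + gauss pi (- R) x)"

definition bumps_norm :: "real \<Rightarrow> real \<Rightarrow> real" where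
  "bumps_norm e R = sqrt (\<integral>x. (bumps e R x)\<^sup>2 \<partial>lborel)"

definition unit_bumps :: "real \<Rightarrow> real \<Rightarrow> real \<Rightarrow> real" where
  "unit_bumps e R x = bumps e R x / bumps_norm e R"

lemma borel_measurable_bumps[measurable]: "bumps e R \<in> borel_measurable borel"
  unfolding bumps_def[abs_def] by measurable

lemma borel_measurable_unit_bumps[measurable]: "unit_bumps e R \<in> borel_measurable borel"
  unfolding unit_bumps_def[abs_def] by measurable

lemma integrable_bumps[simp]: "integrable lborel (bumps e R)"
  unfolding bumps_def[abs_def] by simp

lemma integrable_unit_bumps[simp]: "integrable lborel (unit_bumps e R)"
  unfolding unit_bumps_def[abs_def] by simp

lemma bumps_ge: "0 \<le> e \<Longrightarrow> gauss pi 0 x \<le> bumps e R x"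
  by (simp add: bumps_def gauss_nonneg)

lemma bumps_nonneg: "0 \<le> e \<Longrightarrow> 0 \<le> bumps e R x"
  by (simp add: bumps_def gauss_nonneg)

text \<open>Cauchy-Schwarz with weights 1, \<open>e\<close>, \<open>e\<close>; the difference of the
  two sides is the sum of squares in Lagrange's identity. Integrating it needs no overlap integral
  between different bumps.\<close>

lemma bumps_square_le:
  assumes "0 \<le> e"
  shows "(bumps e R x)\<^sup>2 \<le> (1 + 2 * e) *
    ((gauss pi 0 x)\<^sup>2 + e * (gauss pi R x)\<^sup>2 + e * (gauss pi (- R) x)\<^sup>2)"
proof -
  have "(1 + 2 * e) * (x\<^sup>2 + e * y\<^sup>2 + e * z\<^sup>2) - (x + e * (y + z))\<^sup>2
      = e * (x - y)\<^sup>2 + e * (x - z)\<^sup>2 + e\<^sup>2 * (y - z)\<^sup>2" for x y z :: real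
    by (simp add: power2_eq_square algebra_simps)
  moreover have "0 \<le> e * (x - y)\<^sup>2 + e * (x - z)\<^sup>2 + e\<^sup>2 * (y - z)\<^sup>2" for x y z :: real
    using assms by simp
  ultimately have "(x + e * (y + z))\<^sup>2 \<le> (1 + 2 * e) * (x\<^sup>2 + e * y\<^sup>2 + e * z\<^sup>2)" for x y z :: real
    by (metis diff_ge_0_iff_ge)
  then show ?thesis unfolding bumps_def .
qed

lemma integrable_bumps_square:
  assumes "0 \<le> e"
  shows "integrable lborel (\<lambda>x. (bumps e R x)\<^sup>2)"
proof (rule Bochner_Integration.integrable_bound)
  show "integrable lborel (\<lambda>x. (1 + 2 * e) *
    ((gauss pi 0 x)\<^sup>2 + e * (gauss pi R x)\<^sup>2 + e * (gauss pi (- R) x)\<^sup>2))"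
    by simp
  show "AE x in lborel. norm ((bumps e R x)\<^sup>2) \<le> norm ((1 + 2 * e) *
    ((gauss pi 0 x)\<^sup>2 + e * (gauss pi R x)\<^sup>2 + e * (gauss pi (- R) x)\<^sup>2))"
    using bumps_square_le[OF assms] by (intro AE_I2) (simp add: order_trans[OF _ abs_ge_self])
qed measurable

text \<open>The lower bound is domination of the unit-norm central Gaussian. Neither bound involves
  \<open>R\<close>, which therefore stays free.\<close>

lemma bumps_norm_bounds:
  assumes "0 \<le> e"
  shows "1 \<le> bumps_norm e R" "bumps_norm e R \<le> 1 + 2 * e"
proof -
  have "1 = (\<integral>x. (gauss pi 0 x)\<^sup>2 \<partial>lborel)" by (simp add: integral_gauss_square)
  also have "\<dots> \<le> (\<integral>x. (bumps e R x)\<^sup>2 \<partial>lborel)"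
    using bumps_ge[OF assms] gauss_nonneg
    by (intro integral_mono integrable_bumps_square assms power_mono) auto
  finally show "1 \<le> bumps_norm e R" by (simp add: bumps_norm_def)
  have "(\<integral>x. (bumps e R x)\<^sup>2 \<partial>lborel) \<le> (\<integral>x. (1 + 2 * e) *
    ((gauss pi 0 x)\<^sup>2 + e * (gauss pi R x)\<^sup>2 + e * (gauss pi (- R) x)\<^sup>2) \<partial>lborel)"
    by (intro integral_mono integrable_bumps_square assms bumps_square_le) simp
  also have "\<dots> = (1 + 2 * e)\<^sup>2"
    by (simp add: integral_gauss_square) (simp add: power2_eq_square algebra_simps)
  finally show "bumps_norm e R \<le> 1 + 2 * e"
    using assms unfolding bumps_norm_def by (intro real_le_lsqrt) auto
qed

lemma unit_bumps_nonneg: "0 \<le> e \<Longrightarrow> 0 \<le> unit_bumps e R x"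
  using bumps_nonneg bumps_norm_bounds(1)[of e R] by (simp add: unit_bumps_def)

lemma integral_unit_bumps_square:
  assumes "0 \<le> e"
  shows "(\<integral>x. (unit_bumps e R x)\<^sup>2 \<partial>lborel) = 1"
proof -
  have "(bumps_norm e R)\<^sup>2 = (\<integral>x. (bumps e R x)\<^sup>2 \<partial>lborel)"
    unfolding bumps_norm_def by (simp add: integral_nonneg)
  moreover have "(bumps_norm e R)\<^sup>2 > 0" using bumps_norm_bounds(1)[OF assms, of R] by simp
  ultimately show ?thesis by (simp add: unit_bumps_def power_divide)
qed

lemma unit_bumps_L2:
  assumes "0 \<le> e"
  shows "unit_bumps e R \<in> Lp_space lborel 2" "Lp_norm lborel 2 (unit_bumps e R) = 1"
proof -
  have "integrable lborel (\<lambda>x. (unit_bumps e R x)\<^sup>2)"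
    using integrable_bumps_square[OF assms] by (simp add: unit_bumps_def power_divide)
  then show "unit_bumps e R \<in> Lp_space lborel 2"
    by (simp add: Lp_space_def powr_numeral)
  show "Lp_norm lborel 2 (unit_bumps e R) = 1"
    using integral_unit_bumps_square[OF assms] by (simp add: Lp_norm_def powr_numeral)
qed

lemma gauss_pi_le: "gauss pi r x \<le> 2"
proof -
  have "(2::real) powr (1 / 4) \<le> 2 powr 1" by (intro powr_mono) auto
  moreover have "exp (- pi * (x - r)\<^sup>2) \<le> 1" by simp
  ultimately have "2 powr (1 / 4) * exp (- pi * (x - r)\<^sup>2) \<le> 2 * 1"
    by (intro mult_mono) auto
  then show ?thesis by (simp add: gauss_def)
qed

lemma unit_bumps_le:
  assumes "0 \<le> e" "e \<le> 1"
  shows "unit_bumps e R x \<le> 6"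
proof -
  have "e * (gauss pi R x + gauss pi (- R) x) \<le> 1 * (2 + 2)"
    using assms by (intro mult_mono add_mono gauss_pi_le) (auto simp: gauss_nonneg)
  then have "bumps e R x \<le> 6" using gauss_pi_le[of 0 x] by (simp add: bumps_def)
  then show ?thesis
    using bumps_norm_bounds(1)[OF assms(1), of R] bumps_nonneg[OF assms(1), of R x]
    by (simp add: unit_bumps_def divide_le_eq)
qed

text \<open>Normalization changes the central Gaussian by at most the factor \<open>2 * e\<close>,
  and the two bumps have mass \<open>e\<close> times that of the central one each.\<close>

lemma integral_unit_bumps_diff_le:
  assumes "0 \<le> e"
  shows "(\<integral>x. \<bar>unit_bumps e R x - gauss pi 0 x\<bar> \<partial>lborel) \<le> 4 * e * (\<integral>x. gauss pi 0 x \<partial>lborel)"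
proof -
  let ?N = "bumps_norm e R"
  note N = bumps_norm_bounds[OF assms, of R]
  have "\<bar>unit_bumps e R x - gauss pi 0 x\<bar>
      \<le> 2 * e * gauss pi 0 x + e * (gauss pi R x + gauss pi (- R) x)" for x
  proof -
    define y z where "y = gauss pi 0 x" and "z = e * (gauss pi R x + gauss pi (- R) x)"
    have yz: "0 \<le> y" "0 \<le> z" using assms by (auto simp: y_def z_def gauss_nonneg)
    have "\<bar>(y + z) / ?N - y\<bar> = \<bar>z - (?N - 1) * y\<bar> / ?N"
      using N by (simp add: field_simps)
    also have "\<dots> \<le> \<bar>z - (?N - 1) * y\<bar>" using N by (simp add: divide_le_eq mult_le_cancel_left1)
    also have "\<dots> \<le> z + (?N - 1) * y" using yz N by (simp add: abs_le_iff)
    also have "\<dots> \<le> z + 2 * e * y" using yz N by (simp add: mult_right_mono)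
    finally show ?thesis by (simp add: unit_bumps_def bumps_def y_def z_def)
  qed
  then have "(\<integral>x. \<bar>unit_bumps e R x - gauss pi 0 x\<bar> \<partial>lborel)
     \<le> (\<integral>x. 2 * e * gauss pi 0 x + e * (gauss pi R x + gauss pi (- R) x) \<partial>lborel)"
    by (intro integral_mono) auto
  also have "\<dots> = 4 * e * (\<integral>x. gauss pi 0 x \<partial>lborel)"
    using integral_gauss_shift[of pi R] integral_gauss_shift[of pi "- R"] by simp
  finally show ?thesis .
qed

section \<open>Fourier transform and deficit of the two-bump function\<close>

text \<open>The two translations produce conjugate phases whose sum is twice a cosine. The absolute
  value matters: for \<open>e > 1/2\<close> the factor changes sign, while the entropy lemmas ask
  for a nonnegative amplitude.\<close>

definition fourier_amplitude :: "real \<Rightarrow> real \<Rightarrow> real \<Rightarrow> real" where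
  "fourier_amplitude e R \<xi> = gauss pi 0 \<xi> * (\<bar>1 + 2 * e * cos (2 * pi * R * \<xi>)\<bar> / bumps_norm e R)"

text \<open>The function is integrable, so \<open>fourier\<close> is given by the integral and the
  identity holds at every point, with no choice of a Plancherel limit.\<close>

lemma fourier_unit_bumps:
  "cmod (fourier (\<lambda>x. complex_of_real (unit_bumps e R x)) \<xi>) = fourier_amplitude e R \<xi>"
proof -
  let ?E = "\<lambda>x. exp (- 2 * of_real pi * \<i> * of_real x * of_real \<xi>) :: complex"
  let ?N = "bumps_norm e R"
  have N: "?N \<ge> 0" by (simp add: bumps_norm_def)
  have E: "norm (?E x) = 1" for x by (simp add: norm_exp_eq_Re)
  have i: "integrable lborel (\<lambda>x. ?E x * of_real (gauss pi r x))" for r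
    by (rule Bochner_Integration.integrable_bound[of _ "gauss pi r"])
      (auto simp: norm_mult E gauss_nonneg)
  have "integrable lborel (\<lambda>x. complex_of_real (unit_bumps e R x))"
    by (rule integrable_of_real) simp
  then have "fourier (\<lambda>x. complex_of_real (unit_bumps e R x)) \<xi>
      = fourier_integral (\<lambda>x. complex_of_real (unit_bumps e R x)) \<xi>"
    by (simp add: fourier_def)
  also have "\<dots> = (\<integral>x. (?E x * of_real (gauss pi 0 x) +
       of_real e * (?E x * of_real (gauss pi R x) + ?E x * of_real (gauss pi (- R) x))) / of_real ?N \<partial>lborel)"
    unfolding fourier_integral_def
    by (intro Bochner_Integration.integral_cong refl)
      (simp add: unit_bumps_def bumps_def algebra_simps add_divide_distrib)
  also have "\<dots> = (fourier_integral (\<lambda>x. complex_of_real (gauss pi 0 x)) \<xi> +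
      of_real e * (fourier_integral (\<lambda>x. complex_of_real (gauss pi R x)) \<xi>
        + fourier_integral (\<lambda>x. complex_of_real (gauss pi (- R) x)) \<xi>)) / of_real ?N"
    unfolding fourier_integral_def using i by simp
  also have "\<dots> = of_real (gauss pi 0 \<xi>) * (1 + of_real e * (exp (- (\<i> * of_real (2 * pi * R * \<xi>)))
       + exp (\<i> * of_real (2 * pi * R * \<xi>)))) / of_real ?N"
    unfolding fourier_integral_gauss by (simp add: algebra_simps)
  also have "exp (- (\<i> * of_real (2 * pi * R * \<xi>))) + exp (\<i> * of_real (2 * pi * R * \<xi>))
      = of_real (2 * cos (2 * pi * R * \<xi>))"
    by (simp add: cos_of_real[symmetric] cos_exp_eq)
  also have "of_real (gauss pi 0 \<xi>) * (1 + of_real e * complex_of_real (2 * cos (2 * pi * R * \<xi>))) / of_real ?N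
     = complex_of_real (gauss pi 0 \<xi> * (1 + 2 * e * cos (2 * pi * R * \<xi>)) / ?N)"
    by simp
  finally show ?thesis
    using N by (simp only: norm_of_real) (simp add: fourier_amplitude_def abs_mult gauss_nonneg)
qed

text \<open>The modulus of the oscillating factor and the norm both lie within \<open>2 * e\<close>
  of 1, however fast the oscillation; dividing by a norm of at least 1 does not enlarge their
  difference.\<close>

lemma fourier_amplitude_bounds:
  assumes "0 \<le> e"
  shows "0 \<le> fourier_amplitude e R \<xi>"
    and "fourier_amplitude e R \<xi> \<le> (1 + 2 * e) * gauss pi 0 \<xi>"
    and "\<bar>fourier_amplitude e R \<xi> - gauss pi 0 \<xi>\<bar> \<le> 4 * e * gauss pi 0 \<xi>"
proof -
  let ?N = "bumps_norm e R"
  note N = bumps_norm_bounds[OF assms, of R]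
  define c where "c = 1 + 2 * e * cos (2 * pi * R * \<xi>)"
  have "\<bar>2 * e * cos (2 * pi * R * \<xi>)\<bar> \<le> 2 * e * 1"
    unfolding abs_mult using assms by (intro mult_mono abs_cos_le_one) auto
  then have c: "\<bar>\<bar>c\<bar> - 1\<bar> \<le> 2 * e" unfolding c_def by linarith
  have amp: "fourier_amplitude e R \<xi> = gauss pi 0 \<xi> * (\<bar>c\<bar> / ?N)"
    by (simp add: fourier_amplitude_def c_def)
  show "0 \<le> fourier_amplitude e R \<xi>" using N by (simp add: amp gauss_nonneg)
  have "\<bar>c\<bar> / ?N \<le> \<bar>c\<bar>" using N by (simp add: divide_le_eq mult_le_cancel_left1)
  also have "\<dots> \<le> 1 + 2 * e" using c by linarith
  finally show "fourier_amplitude e R \<xi> \<le> (1 + 2 * e) * gauss pi 0 \<xi>"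
    unfolding amp by (metis gauss_nonneg mult.commute mult_left_mono)
  have "\<bar>\<bar>c\<bar> / ?N - 1\<bar> = \<bar>\<bar>c\<bar> - ?N\<bar> / ?N" using N by (simp add: field_simps)
  also have "\<dots> \<le> \<bar>\<bar>c\<bar> - ?N\<bar>" using N by (simp add: divide_le_eq mult_le_cancel_left1)
  also have "\<dots> \<le> 4 * e" using N c by linarith
  finally have *: "\<bar>\<bar>c\<bar> / ?N - 1\<bar> \<le> 4 * e" .
  have "\<bar>fourier_amplitude e R \<xi> - gauss pi 0 \<xi>\<bar> = gauss pi 0 \<xi> * \<bar>\<bar>c\<bar> / ?N - 1\<bar>"
  proof -
    have "fourier_amplitude e R \<xi> - gauss pi 0 \<xi> = gauss pi 0 \<xi> * (\<bar>c\<bar> / ?N - 1)"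
      by (simp add: amp right_diff_distrib)
    then show ?thesis by (simp only: abs_mult abs_of_nonneg[OF gauss_nonneg])
  qed
  also have "\<dots> \<le> gauss pi 0 \<xi> * (4 * e)"
    using * by (intro mult_left_mono gauss_nonneg)
  finally show "\<bar>fourier_amplitude e R \<xi> - gauss pi 0 \<xi>\<bar> \<le> 4 * e * gauss pi 0 \<xi>"
    by (simp add: mult.commute)
qed

lemma integrable_fourier_amplitude:
  assumes "0 \<le> e"
  shows "integrable lborel (fourier_amplitude e R)"
proof (rule Bochner_Integration.integrable_bound)
  show "integrable lborel (\<lambda>\<xi>. (1 + 2 * e) * gauss pi 0 \<xi>)" by simp
  show "fourier_amplitude e R \<in> borel_measurable lborel"
    unfolding fourier_amplitude_def[abs_def] by measurable
  show "AE \<xi> in lborel. norm (fourier_amplitude e R \<xi>) \<le> norm ((1 + 2 * e) * gauss pi 0 \<xi>)"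
    using fourier_amplitude_bounds(1,2)[OF assms, of R]
    by (intro AE_I2) (simp add: order_trans[OF _ abs_ge_self])
qed

lemma fourier_amplitude_le:
  assumes "0 \<le> e" "e \<le> 1"
  shows "fourier_amplitude e R \<xi> \<le> 6"
proof -
  have "(1 + 2 * e) * gauss pi 0 \<xi> \<le> 3 * 2"
    using assms by (intro mult_mono gauss_pi_le) (auto simp: gauss_nonneg)
  then show ?thesis using fourier_amplitude_bounds(2)[OF assms(1), of R \<xi>] by linarith
qed

lemma integral_fourier_amplitude_diff_le:
  assumes "0 \<le> e"
  shows "(\<integral>\<xi>. \<bar>fourier_amplitude e R \<xi> - gauss pi 0 \<xi>\<bar> \<partial>lborel) \<le> 4 * e * (\<integral>x. gauss pi 0 x \<partial>lborel)"
proof -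
  have "(\<integral>\<xi>. \<bar>fourier_amplitude e R \<xi> - gauss pi 0 \<xi>\<bar> \<partial>lborel) \<le> (\<integral>\<xi>. 4 * e * gauss pi 0 \<xi> \<partial>lborel)"
    using integrable_fourier_amplitude[OF assms] fourier_amplitude_bounds(3)[OF assms]
    by (intro integral_mono) auto
  then show ?thesis by simp
qed

text \<open>In both variables the \<open>L\<^sup>1\<close> distance to \<open>gauss pi 0\<close> is
  at most a fixed multiple of \<open>e k\<close>, and 6 bounds all amplitudes. As \<open>R\<close>
  is arbitrary, it can later grow as fast as the weighted norm requires.\<close>

lemma BH_deficit_unit_bumps_tendsto:
  fixes e R :: "nat \<Rightarrow> real"
  assumes e: "\<And>k. 0 \<le> e k" "\<And>k. e k \<le> 1" "e \<longlonglongrightarrow> 0"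
  shows "(\<lambda>k. BH_deficit (unit_bumps (e k) (R k))) \<longlonglongrightarrow> 0"
proof -
  let ?F = "\<lambda>s::real. s\<^sup>2 * ln (s\<^sup>2)"
  let ?u = "\<lambda>k. unit_bumps (e k) (R k)" and ?v = "\<lambda>k. fourier_amplitude (e k) (R k)"
  let ?g = "gauss pi 0"
  have g: "integrable lborel ?g" "\<And>x. 0 \<le> ?g x" "\<And>x. ?g x \<le> 6"
    by (auto simp: gauss_nonneg intro: order_trans[OF gauss_pi_le])
  have small: "(\<lambda>k. 4 * e k * (\<integral>x. ?g x \<partial>lborel)) \<longlonglongrightarrow> 0"
    using e(3) by (auto intro!: tendsto_eq_intros)
  have "(\<lambda>k. \<integral>x. \<bar>?u k x - ?g x\<bar> \<partial>lborel) \<longlonglongrightarrow> 0"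
    by (rule tendsto_sandwich[OF _ _ tendsto_const small])
      (auto intro!: always_eventually integral_unit_bumps_diff_le e)
  then have u: "(\<lambda>k. \<integral>x. ?F (?u k x) \<partial>lborel) \<longlonglongrightarrow> (\<integral>x. ?F (?g x) \<partial>lborel)"
    using e g unit_bumps_nonneg unit_bumps_le
    by (intro entropy_integral_tendsto[where S = 6]) auto
  have "(\<lambda>k. \<integral>x. \<bar>?v k x - ?g x\<bar> \<partial>lborel) \<longlonglongrightarrow> 0"
    by (rule tendsto_sandwich[OF _ _ tendsto_const small])
      (auto intro!: always_eventually integral_fourier_amplitude_diff_le e)
  then have v: "(\<lambda>k. \<integral>x. ?F (?v k x) \<partial>lborel) \<longlonglongrightarrow> (\<integral>x. ?F (?g x) \<partial>lborel)"
    using e g fourier_amplitude_bounds(1) fourier_amplitude_le integrable_fourier_amplitude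
    by (intro entropy_integral_tendsto[where S = 6]) auto
  have "BH_deficit (?u k)
      = ereal (- (\<integral>x. ?F (?u k x) \<partial>lborel) - (\<integral>x. ?F (?v k x) \<partial>lborel) - (1 - ln 2))" for k
  proof -
    have "integrable lborel (\<lambda>x. ?F (?u k x))" "integrable lborel (\<lambda>x. ?F (?v k x))"
      using e unit_bumps_nonneg unit_bumps_le fourier_amplitude_bounds(1) fourier_amplitude_le
        integrable_fourier_amplitude
      by (auto intro!: integrable_mult_ln[where S = 6])
    from this[THEN shannon_entropy_eq_integral] show ?thesis
      by (simp add: BH_deficit_def fourier_unit_bumps)
  qed
  moreover have "(\<lambda>k. - (\<integral>x. ?F (?u k x) \<partial>lborel) - (\<integral>x. ?F (?v k x) \<partial>lborel) - (1 - ln 2))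
     \<longlonglongrightarrow> - (\<integral>x. ?F (?g x) \<partial>lborel) - (\<integral>x. ?F (?g x) \<partial>lborel) - (1 - ln 2)"
    by (intro tendsto_intros u v)
  ultimately show ?thesis
    by (simp add: integral_gauss_entropy zero_ereal_def)
qed

section \<open>Weighted norm of the two-bump function from above\<close>

lemma unit_bumps_in_Lp_space_eta:
  assumes "p > 0" "l \<ge> 0"
  shows "unit_bumps e R \<in> Lp_space (eta l) p"
proof -
  have "(\<lambda>x. inverse (bumps_norm e R) * (gauss pi 0 x + e * (gauss pi R x + gauss pi (- R) x))) \<in> Lp_space (eta l) p"
    using assms by (intro Lp_space_mult Lp_space_add gauss_in_Lp_space_eta) auto
  moreover have "unit_bumps e R
      = (\<lambda>x. inverse (bumps_norm e R) * (gauss pi 0 x + e * (gauss pi R x + gauss pi (- R) x)))"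
    by (auto simp: unit_bumps_def bumps_def divide_inverse)
  ultimately show ?thesis by metis
qed

text \<open>The condition \<open>1 \<le> e * R powr (l / p)\<close> lets the bumps dominate the
  central Gaussian. The three pieces then have a common bound, whence the factor 3.\<close>

lemma Lp_norm_unit_bumps_le:
  assumes "p > 0" "l \<ge> 0" "0 < e" "R \<ge> 1" "1 \<le> e * R powr (l / p)"
  shows "Lp_norm (eta l) p (unit_bumps e R)
    \<le> (3 * 4 powr p * (\<integral>x. (1 + \<bar>x\<bar>) powr l * gauss pi 0 x powr p \<partial>lborel)) powr (1 / p) * (e * R powr (l / p))"
proof -
  define A where "A = (\<integral>x. (1 + \<bar>x\<bar>) powr l * gauss pi 0 x powr p \<partial>lborel)"
  have A: "A \<ge> 0" by (simp add: A_def)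
  let ?w = "\<lambda>r x. \<bar>x\<bar> powr l * gauss pi r x powr p"
  have wi: "integrable lborel (?w r)" for r
    using assms by (intro integrable_abs_powr_gauss) auto
  have T: "(e * R powr (l / p)) powr p = e powr p * R powr l"
    using assms by (simp add: powr_mult powr_powr)
  have "1 powr p \<le> (e * R powr (l / p)) powr p" using assms by (intro powr_mono2) auto
  then have T1: "1 \<le> e powr p * R powr l" unfolding T by simp
  \<comment> \<open>The factor \<open>4 powr p\<close> comes from splitting a sum twice, each time
    at the cost of \<open>2 powr p\<close>.\<close>
  have pw: "\<bar>unit_bumps e R x\<bar> powr p
      \<le> 4 powr p * (gauss pi 0 x powr p + e powr p * (gauss pi R x powr p + gauss pi (- R) x powr p))" for x
  proof -
    note nn = gauss_nonneg[of pi 0 x] gauss_nonneg[of pi R x] gauss_nonneg[of pi "- R" x]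
    have e0: "0 \<le> e" and p0: "0 \<le> p" using assms by auto
    have "unit_bumps e R x \<le> bumps e R x"
      using bumps_norm_bounds(1)[OF e0, of R] bumps_nonneg[OF e0, of R x]
      by (simp add: unit_bumps_def divide_le_eq mult_le_cancel_left1)
    then have "\<bar>unit_bumps e R x\<bar> powr p \<le> bumps e R x powr p"
      using unit_bumps_nonneg[OF e0, of R x] p0 by (intro powr_mono2) auto
    also have "\<dots> \<le> 2 powr p * (gauss pi 0 x powr p + (e * (gauss pi R x + gauss pi (- R) x)) powr p)"
      unfolding bumps_def using nn e0 p0 by (intro powr_add_le) auto
    also have "\<dots> = 2 powr p * (gauss pi 0 x powr p + e powr p * (gauss pi R x + gauss pi (- R) x) powr p)"
      using nn e0 by (simp add: powr_mult)
    also have "\<dots> \<le> 2 powr p * (2 powr p * gauss pi 0 x powr p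
        + e powr p * (2 powr p * (gauss pi R x powr p + gauss pi (- R) x powr p)))"
    proof (intro mult_left_mono add_mono powr_add_le nn p0)
      have "1 \<le> 2 powr p" using p0 by (simp add: ge_one_powr_ge_zero)
      then show "gauss pi 0 x powr p \<le> 2 powr p * gauss pi 0 x powr p"
        by (simp add: mult_le_cancel_right1)
    qed auto
    also have "\<dots> = (2 * 2) powr p * (gauss pi 0 x powr p + e powr p * (gauss pi R x powr p + gauss pi (- R) x powr p))"
      unfolding powr_mult by (simp only: algebra_simps)
    finally show ?thesis by simp
  qed
  have "(\<integral>x. \<bar>x\<bar> powr l * \<bar>unit_bumps e R x\<bar> powr p \<partial>lborel)
      \<le> (\<integral>x. 4 powr p * (?w 0 x + e powr p * (?w R x + ?w (- R) x)) \<partial>lborel)"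
  proof (rule integral_mono)
    show "integrable lborel (\<lambda>x. \<bar>x\<bar> powr l * \<bar>unit_bumps e R x\<bar> powr p)"
      using unit_bumps_in_Lp_space_eta[of p l] assms by (simp add: Lp_space_eta_iff)
    show "integrable lborel (\<lambda>x. 4 powr p * (?w 0 x + e powr p * (?w R x + ?w (- R) x)))"
      using wi by simp
    show "\<bar>x\<bar> powr l * \<bar>unit_bumps e R x\<bar> powr p \<le> 4 powr p * (?w 0 x + e powr p * (?w R x + ?w (- R) x))" for x
      using mult_left_mono[OF pw, of "\<bar>x\<bar> powr l" x] by (simp add: algebra_simps)
  qed
  also have "\<dots> = 4 powr p * ((\<integral>x. ?w 0 x \<partial>lborel) + e powr p * ((\<integral>x. ?w R x \<partial>lborel) + (\<integral>x. ?w (- R) x \<partial>lborel)))"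
    using wi by simp
  also have "\<dots> \<le> 4 powr p * (A + e powr p * (R powr l * A + R powr l * A))"
    using integral_abs_powr_gauss_le[of p l 1 0] integral_abs_powr_gauss_le[of p l R R]
      integral_abs_powr_gauss_le[of p l R "- R"] assms
    unfolding A_def by (intro mult_left_mono add_mono) auto
  \<comment> \<open>The central contribution is inflated to the scale of the bumps by
    \<open>T1\<close>.\<close>
  also have "\<dots> \<le> 4 powr p * ((e powr p * R powr l) * A + e powr p * (R powr l * A + R powr l * A))"
    using A T1 by (intro mult_left_mono add_mono) (auto simp: mult_le_cancel_right1)
  also have "\<dots> = (3 * 4 powr p * A) * (e * R powr (l / p)) powr p"
    unfolding T by (simp add: algebra_simps)
  finally have "Lp_norm (eta l) p (unit_bumps e R) \<le> ((3 * 4 powr p * A) * (e * R powr (l / p)) powr p) powr (1 / p)"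
    using assms by (subst Lp_norm_eta) (auto intro!: powr_mono2)
  also have "\<dots> = (3 * 4 powr p * A) powr (1 / p) * (e * R powr (l / p))"
    using A assms by (simp add: powr_mult[of "3 * 4 powr p * A"] powr_powr[of "e * R powr (l / p)"])
  finally show ?thesis unfolding A_def .
qed

section \<open>Separation from every Gaussian on some window\<close>

text \<open>Since \<open>unit_bumps e R\<close> has bumps of height about \<open>e\<close> at \<open>\<plusminus>R\<close> but is much smaller just inside
  \<open>R\<close>, a unimodal function that is comparable to it near both \<open>R\<close> and \<open>-R\<close> is too large near
  \<open>R - 3\<close>.\<close>

lemma unit_bumps_windows:
  assumes "0 < e" "e \<le> 1" "3 + 3 / e \<le> R"
  obtains m where "e / 3 \<le> m"
    and "\<And>x. x \<in> {R..R + 1/10} \<Longrightarrow> 9/10 * m \<le> unit_bumps e R x"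
    and "\<And>x. x \<in> {- R - 1/10..- R} \<Longrightarrow> 9/10 * m \<le> unit_bumps e R x"
    and "\<And>x. x \<in> {R - 3..R - 2} \<Longrightarrow> unit_bumps e R x \<le> 3/10 * m"
proof
  define K :: real where "K = 2 powr (1 / 4)"
  have K: "K \<ge> 1" by (simp add: K_def ge_one_powr_ge_zero)
  let ?N = "bumps_norm e R"
  \<comment> \<open>The height at its own centre of one normalized bump.\<close>
  define m where "m = e * K / ?N"
  have N: "1 \<le> ?N" "?N \<le> 3" using bumps_norm_bounds[of e R] assms by auto
  have g: "gauss pi r x = K * exp (- (pi * (x - r)\<^sup>2))" for r x
    by (simp add: gauss_def K_def)
  have R: "R \<ge> 6"
  proof -
    have "1 \<le> 1 / e" using assms by simp
    then show ?thesis using assms(3) by linarith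
  qed
  have "e * 1 / 3 \<le> e * K / ?N" using assms K N by (intro frac_le mult_left_mono) auto
  then show "e / 3 \<le> m" by (simp add: m_def)
  \<comment> \<open>Within 1/10 of the centre the exponent is at most 4/100, so the exponential is
    at least 0.96.\<close>
  have near: "9/10 * m \<le> unit_bumps e R x" if "\<bar>x - r\<bar> \<le> 1/10" "r = R \<or> r = - R" for x r
  proof -
    have "(x - r)\<^sup>2 \<le> (1/10)\<^sup>2" using that by (simp add: abs_le_square_iff[symmetric])
    then have "pi * (x - r)\<^sup>2 \<le> 4 * (1/10)\<^sup>2" using pi_less_4 by (intro mult_mono) auto
    then have "9/10 \<le> exp (- (pi * (x - r)\<^sup>2))"
      using exp_ge_add_one_self[of "- (pi * (x - r)\<^sup>2)"] by (simp add: power2_eq_square)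
    then have "K * (9/10) \<le> gauss pi r x" unfolding g using K by (intro mult_left_mono) auto
    also have "\<dots> \<le> gauss pi R x + gauss pi (- R) x"
      using that gauss_nonneg[of pi R x] gauss_nonneg[of pi "- R" x] by auto
    finally have "e * (K * (9/10)) \<le> bumps e R x"
      unfolding bumps_def using assms gauss_nonneg[of pi 0 x] by (simp add: add_increasing)
    then have "e * (K * (9/10)) / ?N \<le> bumps e R x / ?N" using N by (intro divide_right_mono) auto
    then show ?thesis by (simp add: m_def unit_bumps_def mult_ac)
  qed
  show "9/10 * m \<le> unit_bumps e R x" if "x \<in> {R..R + 1/10}" for x
    using that by (intro near[of x R]) auto
  show "9/10 * m \<le> unit_bumps e R x" if "x \<in> {- R - 1/10..- R}" for x
    using that by (intro near[of x "- R"]) auto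
  \<comment> \<open>Rational decay is enough here and keeps the numerical estimates
    elementary.\<close>
  have decay: "exp (- (pi * y)) \<le> 1 / (1 + 3 * y)" if "y \<ge> 0" for y
  proof -
    have "1 + 3 * y \<le> 1 + pi * y" using pi_gt3 that by (simp add: mult_right_mono)
    also have "\<dots> \<le> exp (pi * y)" by (rule exp_ge_add_one_self)
    finally show ?thesis using that by (simp add: exp_minus field_simps)
  qed
  show "unit_bumps e R x \<le> 3/10 * m" if x: "x \<in> {R - 3..R - 2}" for x
  proof -
    \<comment> \<open>Distance 2 gives 1/(1 + 3 * 4) = 1/13.\<close>
    have far: "gauss pi r x \<le> K * (1/13)" if "\<bar>x - r\<bar> \<ge> 2" for r
    proof -
      have "(x - r)\<^sup>2 \<ge> 2\<^sup>2" using power_mono[OF that, of 2] by simp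
      then have "1 / (1 + 3 * (x - r)\<^sup>2) \<le> 1 / 13" by (intro divide_left_mono) auto
      then show ?thesis unfolding g using K decay[of "(x - r)\<^sup>2"] by (intro mult_left_mono) auto
    qed
    \<comment> \<open>This is where \<open>R\<close> must exceed \<open>3 / e\<close>: the central
      Gaussian has to be small compared with the height \<open>e\<close> of the bumps, not merely
      small.\<close>
    have "3 / e \<le> x" using x assms by auto
    then have "(3 / e)\<^sup>2 \<le> x\<^sup>2" using assms by (intro power_mono) auto
    then have "exp (- (pi * x\<^sup>2)) \<le> 1 / (1 + 3 * (3 / e)\<^sup>2)"
      by (intro order_trans[OF decay[of "x\<^sup>2"]] divide_left_mono)
        (auto intro!: mult_pos_pos add_pos_nonneg)
    also have "\<dots> \<le> e / 10"
    proof -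
      have "10 \<le> 27 / e" using assms by (simp add: field_simps)
      also have "\<dots> = e * (3 * (3 / e)\<^sup>2)" using assms by (simp add: power2_eq_square)
      also have "\<dots> \<le> e * (1 + 3 * (3 / e)\<^sup>2)" using assms by (intro mult_left_mono) auto
      finally show ?thesis
        by (subst pos_divide_le_eq) (auto intro: add_pos_nonneg)
    qed
    finally have "gauss pi 0 x \<le> K * (e / 10)" unfolding g using K by (simp add: mult_left_mono)
    moreover have "e * (gauss pi R x + gauss pi (- R) x) \<le> e * (K * (1/13) + K * (1/13))"
      using x R assms by (intro mult_left_mono add_mono far) auto
    ultimately have "bumps e R x \<le> K * (e / 10) + e * (K * (1/13) + K * (1/13))"
      unfolding bumps_def by linarith
    also have "\<dots> = (1/10 + 2/13) * (e * K)" by (simp add: algebra_simps)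
    also have "\<dots> \<le> 3/10 * (e * K)" using assms K by (intro mult_right_mono) auto
    finally have "bumps e R x / ?N \<le> 3/10 * (e * K) / ?N" using N by (intro divide_right_mono) auto
    then show ?thesis by (simp add: m_def unit_bumps_def)
  qed
qed

text \<open>The threshold \<open>6/10 * m\<close> lies midway between \<open>3/10 * m\<close> and
  \<open>9/10 * m\<close>. A Gaussian staying below it near one bump misses that bump; one exceeding
  it near both is, by unimodality, too large in the gap. The error is at least
  \<open>3/10 * m\<close>, hence at least \<open>e / 10\<close>.\<close>

lemma unit_bumps_gauss_gap:
  assumes "0 < e" "e \<le> 1" "3 + 3 / e \<le> R" "a > 0"
  obtains s where "\<And>x. x \<in> {s..s + 1/10} \<Longrightarrow> R / 2 \<le> \<bar>x\<bar>"
    and "\<And>x. x \<in> {s..s + 1/10} \<Longrightarrow> e / 10 \<le> \<bar>unit_bumps e R x - gauss a r x\<bar>"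
proof -
  obtain m where m: "e / 3 \<le> m"
    and right: "\<And>x. x \<in> {R..R + 1/10} \<Longrightarrow> 9/10 * m \<le> unit_bumps e R x"
    and left: "\<And>x. x \<in> {- R - 1/10..- R} \<Longrightarrow> 9/10 * m \<le> unit_bumps e R x"
    and mid: "\<And>x. x \<in> {R - 3..R - 2} \<Longrightarrow> unit_bumps e R x \<le> 3/10 * m"
    using unit_bumps_windows[OF assms(1-3)] by metis
  have "1 \<le> 1 / e" using assms by simp
  then have R: "R \<ge> 6" using assms(3) by linarith
  let ?u = "gauss a r"
  consider (right) "\<forall>x\<in>{R..R + 1/10}. ?u x \<le> 6/10 * m"
    | (left) "\<forall>x\<in>{- R - 1/10..- R}. ?u x \<le> 6/10 * m"
    | (both) y z where "y \<in> {- R - 1/10..- R}" "6/10 * m < ?u y" "z \<in> {R..R + 1/10}" "6/10 * m < ?u z"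
    by (meson not_le)
  then show ?thesis
  proof cases
    case right': right
    show ?thesis
    proof (rule that[of R])
      fix x assume x: "x \<in> {R..R + 1/10}"
      show "R / 2 \<le> \<bar>x\<bar>" using x R by auto
      have "?u x \<le> 6/10 * m" using right' x by blast
      then show "e / 10 \<le> \<bar>unit_bumps e R x - gauss a r x\<bar>" using right[OF x] m by linarith
    qed
  next
    case left': left
    show ?thesis
    proof (rule that[of "- R - 1/10"])
      fix x assume "x \<in> {- R - 1/10..- R - 1/10 + 1/10}"
      then have x: "x \<in> {- R - 1/10..- R}" by simp
      show "R / 2 \<le> \<bar>x\<bar>" using x R by auto
      have "?u x \<le> 6/10 * m" using left' x by blast
      then show "e / 10 \<le> \<bar>unit_bumps e R x - gauss a r x\<bar>" using left[OF x] m by linarith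
    qed
  next
    case both
    show ?thesis
    \<comment> \<open>As \<open>R \<ge> 6\<close>, this window still lies at distance at least
      \<open>R / 2\<close> from the origin.\<close>
    proof (rule that[of "R - 3"])
      fix x assume x: "x \<in> {R - 3..R - 3 + 1/10}"
      show "R / 2 \<le> \<bar>x\<bar>" using x R by auto
      have "min (?u y) (?u z) \<le> ?u x" using assms both x R by (intro gauss_unimodal) auto
      then have "6/10 * m < ?u x" using both by (auto simp: min_def split: if_splits)
      moreover have "unit_bumps e R x \<le> 3/10 * m" using x by (intro mid) auto
      ultimately show "e / 10 \<le> \<bar>unit_bumps e R x - gauss a r x\<bar>" using m by linarith
    qed
  qed
qed

section \<open>Weighted lower bounds for the norm and for the distance\<close>

lemma window_weight:
  fixes R l p :: real
  assumes "R > 0"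
  shows "(1/10 * (R / 2) powr l) powr (1 / p) = (1/10 * (1/2) powr l) powr (1 / p) * R powr (l / p)"
proof -
  have "1/10 * (R / 2) powr l = 1/10 * (1/2) powr l * R powr l"
    using assms by (simp add: powr_mult[symmetric])
  then show ?thesis using assms by (simp only: powr_mult powr_powr) simp
qed

text \<open>The window may depend on \<open>a\<close> and \<open>r\<close>, but its length and the
  bounds on it do not, so the estimate survives the infimum over all Gaussians.\<close>

lemma Lp_norm_unit_bumps_diff_gauss_ge:
  assumes "p > 0" "l \<ge> 0" "0 < e" "e \<le> 1" "3 + 3 / e \<le> R" "a > 0"
  shows "1/10 * (1/10 * (1/2) powr l) powr (1 / p) * (e * R powr (l / p))
    \<le> Lp_norm (eta l) p (\<lambda>x. unit_bumps e R x - gauss a r x)"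
proof -
  have "0 \<le> 3 / e" using assms by simp
  then have R: "R > 0" using assms(5) by linarith
  obtain s where s: "\<And>x. x \<in> {s..s + 1/10} \<Longrightarrow> R / 2 \<le> \<bar>x\<bar>"
    "\<And>x. x \<in> {s..s + 1/10} \<Longrightarrow> e / 10 \<le> \<bar>unit_bumps e R x - gauss a r x\<bar>"
    using unit_bumps_gauss_gap[OF assms(3-6)] by metis
  have "e / 10 * (1/10 * (R / 2) powr l) powr (1 / p)
      \<le> Lp_norm (eta l) p (\<lambda>x. unit_bumps e R x - gauss a r x)"
    using assms R s
    by (intro Lp_norm_eta_ge_interval[where s = s] Lp_space_diff unit_bumps_in_Lp_space_eta gauss_in_Lp_space_eta)
      auto
  then show ?thesis unfolding window_weight[OF R] by (simp add: mult_ac)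
qed

text \<open>The right bump alone suffices. The constant is deliberately that of the distance
  estimate, so that both are governed by the same scale.\<close>

lemma Lp_norm_unit_bumps_ge:
  assumes "p > 0" "l \<ge> 0" "0 < e" "e \<le> 1" "3 + 3 / e \<le> R"
  shows "1/10 * (1/10 * (1/2) powr l) powr (1 / p) * (e * R powr (l / p)) \<le> Lp_norm (eta l) p (unit_bumps e R)"
proof -
  have "0 \<le> 3 / e" using assms by simp
  then have R: "R > 0" using assms(5) by linarith
  obtain m where m: "e / 3 \<le> m" "\<And>x. x \<in> {R..R + 1/10} \<Longrightarrow> 9/10 * m \<le> unit_bumps e R x"
    using unit_bumps_windows[OF assms(3-5)] by metis
  have "e / 10 \<le> \<bar>unit_bumps e R x\<bar>" if "x \<in> {R..R + 1/10}" for x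
    using m(1) m(2)[OF that] assms by linarith
  then have "e / 10 * (1/10 * (R / 2) powr l) powr (1 / p) \<le> Lp_norm (eta l) p (unit_bumps e R)"
    using assms R
    by (intro Lp_norm_eta_ge_interval[where s = R] unit_bumps_in_Lp_space_eta) auto
  then show ?thesis unfolding window_weight[OF R] by (simp add: mult_ac)
qed

theorem theorem1p11:
  fixes l p :: real
  assumes "l > 0" and "p \<ge> 2 * (l + 1)"
  shows "\<exists>C::real. C > 0 \<and>
    (\<exists>h :: nat \<Rightarrow> real \<Rightarrow> real.
       (\<forall>k\<ge>1. (\<forall>x. h k x \<ge> 0) \<and> h k \<in> Lp_space (eta l) p \<and>
               h k \<in> Lp_space lborel 2 \<and> Lp_norm lborel 2 (h k) = 1) \<and>
       (\<lambda>k. BH_deficit (h k)) \<longlonglongrightarrow> 0 \<and>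
       filterlim (\<lambda>k. Lp_norm (eta l) p (h k)) at_top sequentially \<and>
       liminf (\<lambda>k. ereal (Lp_dist (eta l) p (h k) gaussians / Lp_norm (eta l) p (h k)))
         \<ge> ereal C)"
proof -
  have p: "p > 0" "l \<ge> 0" "1 \<le> 2 * p / l" using assms by (auto simp: field_simps)
  \<comment> \<open>The successor keeps \<open>e\<close> and \<open>R\<close> meaningful at index 0,
    so all bounds hold for every \<open>k\<close>.\<close>
  define n where "n k = real (Suc k)" for k
  define e where "e k = 1 / n k" for k
  \<comment> \<open>The exponent makes \<open>R k powr (l / p)\<close> at least
    \<open>(n k)\<^sup>2\<close>, which beats \<open>e k\<close> and leaves
    \<open>T k \<ge> n k\<close>. The factor 6 secures \<open>3 + 3 * n k \<le> R k\<close>, since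
    the exponent is at least 1.\<close>
  define R where "R k = 6 * n k powr (2 * p / l)" for k
  define T where "T k = e k * R k powr (l / p)" for k
  define h where "h k = unit_bumps (e k) (R k)" for k
  define D where "D = 1/10 * (1/10 * (1/2) powr l) powr (1 / p)"
  define U where "U = (3 * 4 powr p * (\<integral>x. (1 + \<bar>x\<bar>) powr l * gauss pi 0 x powr p \<partial>lborel)) powr (1 / p)"
  have n: "n k \<ge> 1" for k by (simp add: n_def)
  have e: "0 < e k" "e k \<le> 1" for k using n[of k] by (auto simp: e_def)
  have R: "3 + 3 / e k \<le> R k" "1 \<le> R k" for k
  proof -
    have "n k powr 1 \<le> n k powr (2 * p / l)" using n p by (intro powr_mono) auto
    then show "3 + 3 / e k \<le> R k" "1 \<le> R k" using n[of k] by (auto simp: e_def R_def)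
  qed
  have T: "n k \<le> T k" for k
  proof -
    have "n k = e k * (n k powr (2 * p / l)) powr (l / p)"
      using n[of k] p assms by (simp add: e_def powr_powr powr_numeral power2_eq_square)
    also have "\<dots> \<le> T k"
      using e[of k] p unfolding T_def R_def by (intro mult_left_mono powr_mono2) auto
    finally show ?thesis .
  qed
  have T1: "1 \<le> T k" for k using T n order_trans by blast
  have D: "D > 0" by (simp add: D_def)
  have lower: "D * T k \<le> Lp_norm (eta l) p (h k)" for k
    unfolding D_def T_def h_def by (intro Lp_norm_unit_bumps_ge p e R)
  have upper: "Lp_norm (eta l) p (h k) \<le> U * T k" for k
    using T1[of k] unfolding U_def T_def h_def by (intro Lp_norm_unit_bumps_le p e R)
  have dist: "D * T k \<le> Lp_dist (eta l) p (h k) gaussians" for k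
    unfolding Lp_dist_def
  proof (rule cINF_greatest)
    show "gaussians \<noteq> {}" unfolding gaussians_def using zero_less_one by blast
    fix u assume "u \<in> gaussians"
    then obtain a r where "a > 0" "u = gauss a r" by (auto simp: gaussians_def)
    then show "D * T k \<le> Lp_norm (eta l) p (\<lambda>x. h k x - u x)"
      using Lp_norm_unit_bumps_diff_gauss_ge[OF p(1,2) e R(1), of a k r]
      unfolding D_def T_def h_def by blast
  qed
  have DT: "D * T k > 0" for k using D T1[of k] by simp
  \<comment> \<open>Positivity is read off from the squeeze between \<open>D * T k\<close> and
    \<open>U * T k\<close>, without examining the integral in \<open>U\<close>.\<close>
  have U: "U > 0"
    using DT[of 0] lower[of 0] upper[of 0] T1[of 0] by (smt (verit) mult_nonpos_nonneg)
  \<comment> \<open>Distance and norm share the scale \<open>T k\<close>, which cancels and leaves a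
    constant depending on \<open>p\<close> and \<open>l\<close> alone.\<close>
  have ratio: "D / U \<le> Lp_dist (eta l) p (h k) gaussians / Lp_norm (eta l) p (h k)" for k
  proof -
    have "D / U = (D * T k) / (U * T k)" using T1[of k] by simp
    also have "\<dots> \<le> Lp_dist (eta l) p (h k) gaussians / Lp_norm (eta l) p (h k)"
      using DT[of k] dist[of k] lower[of k] upper[of k] by (intro frac_le) auto
    finally show ?thesis .
  qed
  have "e \<longlonglongrightarrow> 0"
    unfolding e_def n_def using LIMSEQ_inverse_real_of_nat by (simp add: inverse_eq_divide)
  then have deficit: "(\<lambda>k. BH_deficit (h k)) \<longlonglongrightarrow> 0"
    unfolding h_def using e by (intro BH_deficit_unit_bumps_tendsto) (auto intro: less_imp_le)
  have "filterlim (\<lambda>k. D * n k) at_top sequentially"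
    unfolding n_def
    by (intro filterlim_tendsto_pos_mult_at_top[OF tendsto_const D]
        filterlim_compose[OF filterlim_real_sequentially filterlim_Suc])
  moreover have "D * n k \<le> Lp_norm (eta l) p (h k)" for k
    using lower[of k] mult_left_mono[OF T[of k], of D] D by linarith
  ultimately have norm: "filterlim (\<lambda>k. Lp_norm (eta l) p (h k)) at_top sequentially"
    by (rule filterlim_at_top_mono[OF _ always_eventually[OF allI]])
  have "ereal (D / U) \<le> liminf (\<lambda>k. ereal (Lp_dist (eta l) p (h k) gaussians / Lp_norm (eta l) p (h k)))"
    using ratio by (intro Liminf_bounded always_eventually) simp
  moreover have "\<forall>k\<ge>1. (\<forall>x. h k x \<ge> 0) \<and> h k \<in> Lp_space (eta l) p \<and>
      h k \<in> Lp_space lborel 2 \<and> Lp_norm lborel 2 (h k) = 1"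
    using e p unfolding h_def
    by (simp add: unit_bumps_nonneg unit_bumps_L2 unit_bumps_in_Lp_space_eta less_imp_le)
  ultimately show ?thesis
    using deficit norm D U by (intro exI[of _ "D / U"] conjI exI[of _ h]) auto
qed

end
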